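(* In the class of $(p,q)$-Toeplitz words, amorphic complexity takes (at least) a dense set of values in $[1,\infty)$. That is, the set of all numbers $\mathrm{ac}(\sigma|_{\Sigma_\omega})$, where $\omega$ ranges over all $(p,q)$-Toeplitz words (with arbitrary $p,q$) for which the amorphic complexity exists, contains a dense subset of $[1,\infty)$.
   Context: Amorphic complexity. Let $(X,d)$ be a metric space and $f:X\to X$. For $x,y\in X$, $\delta>0$, $n\in\mathbb{N}$ let $S_n(f,\delta,x,y)=\#\{0\le k<n \mid d(f^k(x),f^k(y))\ge\delta\}$. For $\nu\in(0,1]$, points $x,y$ are $(f,\delta,\nu)$-separated if $\limsup_{n\to\infty} S_n(f,\delta,x,y)/n\ge\nu$. A subset is $(f,\delta,\nu)$-separated if all pairs of distinct points of it are. $\operatorname{Sep}(f,\delta,\nu)$ is the largest cardinality (possibly $\infty$) of an $(f,\delta,\nu)$-separated subset of $X$. Set $\underline{\mathrm{ac}}(f)=\sup_{\delta>0}\liminf_{\nu\to0}\frac{\log\operatorname{Sep}(f,\delta,\nu)}{-\log\nu}$ and $\overline{\mathrm{ac}}(f)=\sup_{\delta>0}\limsup_{\nu\to0}\frac{\log\operatorname{Sep}(f,\delta,\nu)}{-\log\nu}$; if they coincide, the amorphic complexity $\mathrm{ac}(f)$ exists and is the common value. Sequences. Let $A$ be a finite alphabet and $\mathcal{A}=A\cup\{\ast\}$ with an extra symbol $\ast$ (hole); sequences are indexed by $\mathbb{N}_0$. $\Sigma_A=A^{\mathbb{N}_0}$ and $\Sigma_{\mathcal{A}}=\mathcal{A}^{\mathbb{N}_0}$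 carry the metric $\rho(x,y)=2^{-j}$, $j=\min\{k : x_k\ne y_k\}$ for $x\neq y$; $\sigma$ is the left shift; $\Sigma_\omega$ is the shift orbit closure of $\omega$. A sequence $\omega\in\Sigma_A$ is called Toeplitz if for every $k\in\mathbb{N}_0$ there is $p\in\mathbb{N}$ with $\omega_{k+p\ell}=\omega_k$ for all $\ell\in\mathbb{N}$. Equivalently, $\omega$ has an approximating sequence, i.e. a sequence $(\omega^\ell)_{\ell\in\mathbb{N}}$ of periodic points of $(\Sigma_{\mathcal{A}},\sigma)$ such that for all $k$ one has $\omega^{\ell+1}_k=\omega^\ell_k$ as soon as $\omega^\ell_k\in A$ for some $\ell$, and $\omega_k=\lim_{\ell\to\infty}\omega^\ell_k$. $(p,q)$-Toeplitz words. Let $v$ be a finite and non-empty word with letters in $\mathcal{A}$ and at least one entry distinct from $\ast$. Let $\overline{v}\in\Sigma_{\mathcal{A}}$ be the one-sided periodic sequence $vvv\cdots$ obtained by repeating $v$ infinitely often. Let $F_v:\Sigma_{\mathcal{A}}\to\Sigma_{\mathcal{A}}$ assign to each $x$ the sequence obtained from $\overline{v}$ by replacing the subsequence of all occurrences of $\ast$ in $\overline{v}$ by $x$. Put $T_0(v)=\overline{\ast}$ and $T_\ell(v)=F_v(T_{\ell-1}(v))$ for $\ell\ge1$. The sequence $(T_\ell(v))_{\ell\in\mathbb{N}}$ is taken as approximating sequence, and $T(v)$ denotes the corresponding Toeplitz sequence, $T(v)_k=\lim_{\ell\to\infty}T_\ell(v)_k$. With $p$ the length of $v$ and $q$ the number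 of letters $\ast$ in $v$, $T(v)$ is called a $(p,q)$-Toeplitz word. *)

theory Defs
  imports "HOL-Analysis.Analysis"
begin

section \<open>Amorphic complexity\<close>

definition separation_count ::
    "'a metric \<Rightarrow> ('a \<Rightarrow> 'a) \<Rightarrow> real \<Rightarrow> 'a \<Rightarrow> 'a \<Rightarrow> nat \<Rightarrow> nat" where
  "separation_count m f \<delta> x y n = card {k. k < n \<and> \<delta> \<le> mdist m ((f ^^ k) x) ((f ^^ k) y)}"

definition separated_points ::
    "'a metric \<Rightarrow> ('a \<Rightarrow> 'a) \<Rightarrow> real \<Rightarrow> real \<Rightarrow> 'a \<Rightarrow> 'a \<Rightarrow> bool" where
  "separated_points m f \<delta> \<nu> x y \<longleftrightarrow>
     ereal \<nu> \<le> limsup (\<lambda>n. ereal (real (separation_count m f \<delta> x y n) / real n))"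

definition separated_set ::
    "'a metric \<Rightarrow> ('a \<Rightarrow> 'a) \<Rightarrow> real \<Rightarrow> real \<Rightarrow> 'a set \<Rightarrow> bool" where
  "separated_set m f \<delta> \<nu> S \<longleftrightarrow>
     S \<subseteq> mspace m \<and> (\<forall>x\<in>S. \<forall>y\<in>S. x \<noteq> y \<longrightarrow> separated_points m f \<delta> \<nu> x y)"

definition separation_number ::
    "'a metric \<Rightarrow> ('a \<Rightarrow> 'a) \<Rightarrow> real \<Rightarrow> real \<Rightarrow> enat" where
  "separation_number m f \<delta> \<nu> =
     Sup {if finite S then enat (card S) else \<infinity> | S. separated_set m f \<delta> \<nu> S}"

definition ln_enat :: "enat \<Rightarrow> ereal" where
  "ln_enat n = (case n of enat k \<Rightarrow> (if k = 0 then -\<infinity> else ereal (ln (real k))) | \<infinity> \<Rightarrow> \<infinity>)"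

definition lower_amorphic_complexity :: "'a metric \<Rightarrow> ('a \<Rightarrow> 'a) \<Rightarrow> ereal" where
  "lower_amorphic_complexity m f =
     (SUP \<delta>\<in>{0<..}. Liminf (at_right 0)
        (\<lambda>\<nu>. ln_enat (separation_number m f \<delta> \<nu>) / ereal (- ln \<nu>)))"

definition upper_amorphic_complexity :: "'a metric \<Rightarrow> ('a \<Rightarrow> 'a) \<Rightarrow> ereal" where
  "upper_amorphic_complexity m f =
     (SUP \<delta>\<in>{0<..}. Limsup (at_right 0)
        (\<lambda>\<nu>. ln_enat (separation_number m f \<delta> \<nu>) / ereal (- ln \<nu>)))"

text \<open>The amorphic complexity exists and equals \<open>a\<close>.\<close>

definition has_amorphic_complexity :: "'a metric \<Rightarrow> ('a \<Rightarrow> 'a) \<Rightarrow> ereal \<Rightarrow> bool" where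
  "has_amorphic_complexity m f a \<longleftrightarrow>
     lower_amorphic_complexity m f = a \<and> upper_amorphic_complexity m f = a"


section \<open>Sequence spaces and subshifts\<close>

definition seq_dist :: "(nat \<Rightarrow> 'a) \<Rightarrow> (nat \<Rightarrow> 'a) \<Rightarrow> real" where
  "seq_dist x y = (if x = y then 0 else (1/2) ^ (LEAST k. x k \<noteq> y k))"

definition seq_metric :: "(nat \<Rightarrow> 'a) metric" where
  "seq_metric = metric (UNIV, seq_dist)"

definition shift :: "(nat \<Rightarrow> 'a) \<Rightarrow> nat \<Rightarrow> 'a" where
  "shift x = (\<lambda>k. x (Suc k))"

definition shift_orbit_closure :: "(nat \<Rightarrow> 'a) \<Rightarrow> (nat \<Rightarrow> 'a) set" where
  "shift_orbit_closure \<omega> = mtopology_of seq_metric closure_of range (\<lambda>n. (shift ^^ n) \<omega>)"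

definition subshift_metric :: "(nat \<Rightarrow> 'a) \<Rightarrow> (nat \<Rightarrow> 'a) metric" where
  "subshift_metric \<omega> = submetric seq_metric (shift_orbit_closure \<omega>)"

lemma seq_dist_triangle: "seq_dist x z \<le> seq_dist x y + seq_dist y z"
proof -
  have nonneg: "0 \<le> seq_dist a b" for a b :: "nat \<Rightarrow> 'a"
    by (simp add: seq_dist_def)
  have le: "(1/2) ^ i \<le> seq_dist a b" if "a i \<noteq> b i" for a b :: "nat \<Rightarrow> 'a" and i
  proof -
    have "(LEAST k. a k \<noteq> b k) \<le> i"
      using that by (rule Least_le)
    then have "(1/2::real) ^ i \<le> (1/2) ^ (LEAST k. a k \<noteq> b k)"
      by (rule power_decreasing) simp_all
    moreover have "a \<noteq> b" using that by blast
    ultimately show ?thesis by (simp add: seq_dist_def)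
  qed
  show ?thesis
  proof (cases "x = z")
    case True
    have "seq_dist x z = 0" using True by (simp add: seq_dist_def)
    then show ?thesis using nonneg[of x y] nonneg[of y z] by linarith
  next
    case False
    define i where "i = (LEAST k. x k \<noteq> z k)"
    have "\<exists>k. x k \<noteq> z k" using False by blast
    then have "x i \<noteq> z i" unfolding i_def by (rule LeastI_ex)
    then have "x i \<noteq> y i \<or> y i \<noteq> z i" by metis
    then have "(1/2) ^ i \<le> seq_dist x y \<or> (1/2) ^ i \<le> seq_dist y z"
      using le by blast
    moreover have "seq_dist x z = (1/2) ^ i"
      using False by (simp add: seq_dist_def i_def)
    ultimately show ?thesis using nonneg[of x y] nonneg[of y z] by linarith
  qed
qed

lemma Metric_space_seq_dist: "Metric_space UNIV seq_dist"
proof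
  show "seq_dist x y = seq_dist y x" for x y :: "nat \<Rightarrow> 'a"
    by (simp only: seq_dist_def eq_commute[of x y] eq_commute[of "x k" "y k" for k])
qed (simp_all add: seq_dist_triangle, simp_all add: seq_dist_def)

lemma mspace_seq_metric [simp]: "mspace seq_metric = UNIV"
  and mdist_seq_metric [simp]: "mdist seq_metric = seq_dist"
  by (simp_all add: seq_metric_def Metric_space.mspace_metric Metric_space.mdist_metric
      Metric_space_seq_dist)


section \<open>Toeplitz sequences and Toeplitz words\<close>

definition toeplitz :: "(nat \<Rightarrow> 'a) \<Rightarrow> bool" where
  "toeplitz \<omega> \<longleftrightarrow> (\<forall>k. \<exists>p>0. \<forall>l. \<omega> (k + p * l) = \<omega> k)"

text \<open>The alphabet extended by the hole is \<^typ>\<open>'a option\<close>: \<^const>\<open>None\<close> is the hole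
  and \<^term>\<open>Some a\<close> is the letter \<open>a\<close>.\<close>

definition periodic_word :: "'a option list \<Rightarrow> nat \<Rightarrow> 'a option" where
  "periodic_word v k = v ! (k mod length v)"

text \<open>The hole at position \<open>k\<close> is preceded by \<open>holes_below v k\<close> holes, so it is the one that
  receives the letter of \<open>x\<close> with this index.\<close>

definition holes_below :: "'a option list \<Rightarrow> nat \<Rightarrow> nat" where
  "holes_below v k = card {j. j < k \<and> periodic_word v j = None}"

definition fill_holes :: "'a option list \<Rightarrow> (nat \<Rightarrow> 'a option) \<Rightarrow> nat \<Rightarrow> 'a option" where
  "fill_holes v x k =
     (case periodic_word v k of Some a \<Rightarrow> Some a | None \<Rightarrow> x (holes_below v k))"

primrec toeplitz_approx :: "'a option list \<Rightarrow> nat \<Rightarrow> nat \<Rightarrow> 'a option" where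
  "toeplitz_approx v 0 = (\<lambda>_. None)"
| "toeplitz_approx v (Suc l) = fill_holes v (toeplitz_approx v l)"

text \<open>Convergence at each position is with respect to the discrete alphabet. The limit \<open>\<omega>\<close> is
  required to have letters of the alphabet only; if \<open>v\<close> begins with a hole, then position 0 is
  never filled and \<open>v\<close> does not define a Toeplitz word.\<close>

definition is_toeplitz_word :: "nat \<Rightarrow> nat \<Rightarrow> (nat \<Rightarrow> 'a) \<Rightarrow> bool" where
  "is_toeplitz_word p q \<omega> \<longleftrightarrow>
     (\<exists>v. v \<noteq> [] \<and> (\<exists>c\<in>set v. c \<noteq> None) \<and> length v = p \<and> count_list v None = q \<and>
          (\<forall>k. eventually (\<lambda>l. toeplitz_approx v l k = Some (\<omega> k)) sequentially))"

lemma periodic_word_add_length: "periodic_word v (k + length v) = periodic_word v k"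
  by (simp add: periodic_word_def)

lemma periodic_word_add: "periodic_word v (k + length v * s) = periodic_word v k"
  by (simp add: periodic_word_def)

lemma holes_below_add_length:
  "holes_below v (k + length v) = holes_below v k + holes_below v (length v)"
proof -
  let ?p = "length v"
  let ?A = "{j. j < ?p \<and> periodic_word v j = None}"
  let ?B = "{j. j < k \<and> periodic_word v j = None}"
  have "{j. j < k + ?p \<and> periodic_word v j = None} = ?A \<union> (\<lambda>j. j + ?p) ` ?B"
  proof (intro set_eqI iffI)
    fix j assume j: "j \<in> {j. j < k + ?p \<and> periodic_word v j = None}"
    show "j \<in> ?A \<union> (\<lambda>j. j + ?p) ` ?B"
    proof (cases "j < ?p")
      case False
      then have "j = (j - ?p) + ?p" by simp
      moreover have "j - ?p \<in> ?B"
        using j False periodic_word_add_length[of v "j - ?p"] by auto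
      ultimately show ?thesis by blast
    qed (use j in auto)
  qed (auto simp: periodic_word_add_length)
  then have "holes_below v (k + ?p) = card ?A + card ((\<lambda>j. j + ?p) ` ?B)"
    unfolding holes_below_def by (simp only:) (intro card_Un_disjoint; auto)
  also have "card ((\<lambda>j. j + ?p) ` ?B) = card ?B"
    by (intro card_image) (auto simp: inj_on_def)
  finally show ?thesis by (simp add: holes_below_def)
qed

lemma holes_below_add:
  "holes_below v (k + length v * s) = holes_below v k + holes_below v (length v) * s"
proof (induction s)
  case (Suc s)
  have "holes_below v (k + length v * Suc s) = holes_below v ((k + length v * s) + length v)"
    by (simp add: algebra_simps)
  then show ?case
    unfolding holes_below_add_length Suc by simp
qed simp

lemma toeplitz_approx_periodic:
  "toeplitz_approx v l (k + length v ^ l * n) = toeplitz_approx v l k"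
proof (induction l arbitrary: k n)
  case (Suc l)
  have eq: "k + length v ^ Suc l * n = k + length v * (length v ^ l * n)"
    by (simp add: algebra_simps)
  have "toeplitz_approx v l (holes_below v (k + length v * (length v ^ l * n))) =
      toeplitz_approx v l (holes_below v k)"
    using Suc[of "holes_below v k" "holes_below v (length v) * n"]
    unfolding holes_below_add by (simp add: ac_simps)
  then show ?case
    unfolding eq by (simp add: fill_holes_def periodic_word_add split: option.split)
qed simp

lemma toeplitz_approx_mono:
  "toeplitz_approx v l k = Some a \<Longrightarrow> toeplitz_approx v (Suc l) k = Some a"
proof (induction l arbitrary: k)
  case (Suc l)
  then show ?case
    by (fastforce simp: fill_holes_def split: option.splits)
qed simp

lemma is_toeplitz_word_imp_toeplitz:
  assumes "is_toeplitz_word p q \<omega>"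
  shows "toeplitz \<omega>"
  unfolding toeplitz_def
proof
  fix k
  obtain v where v: "v \<noteq> []"
    and lim: "\<And>k. eventually (\<lambda>l. toeplitz_approx v l k = Some (\<omega> k)) sequentially"
    using assms unfolding is_toeplitz_word_def by blast
  obtain l where l: "toeplitz_approx v l k = Some (\<omega> k)"
    using lim[of k] unfolding eventually_sequentially by blast
  have "\<omega> (k + length v ^ l * n) = \<omega> k" for n
  proof -
    have *: "toeplitz_approx v l (k + length v ^ l * n) = Some (\<omega> k)"
      using l by (simp add: toeplitz_approx_periodic)
    have mono: "toeplitz_approx v l' (k + length v ^ l * n) = Some (\<omega> k)" if "l \<le> l'" for l'
      using that by (induction l' rule: dec_induct) (auto intro: * toeplitz_approx_mono
          simp del: toeplitz_approx.simps)
    obtain N where "\<And>l'. l' \<ge> N \<Longrightarrow>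
        toeplitz_approx v l' (k + length v ^ l * n) = Some (\<omega> (k + length v ^ l * n))"
      using lim[of "k + length v ^ l * n"] unfolding eventually_sequentially by blast
    from this[of "max N l"] mono[of "max N l"] show ?thesis by simp
  qed
  moreover have "length v ^ l > 0" using v by simp
  ultimately show "\<exists>p>0. \<forall>n. \<omega> (k + p * n) = \<omega> k" by blast
qed

end

theory Submission
  imports Defs
begin

text \<open>
  Let \<open>v = a b\<^sup>p\<^sup>-\<^sup>q\<^sup>-\<^sup>1 \<ast>\<^sup>q\<close> with \<open>p\<close> and \<open>q\<close> coprime and \<open>2 q < p\<close>. The sequence \<open>T\<^sub>\<ell>(v)\<close> has
  period \<open>p\<^sup>\<ell>\<close> and \<open>q\<^sup>\<ell>\<close> holes per period. Points of the orbit closure that follow the same shift of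
  \<open>T\<^sub>\<ell>(v)\<close> can differ only in the holes, so at a separation frequency of larger order than
  \<open>(q/p)\<^sup>\<ell>\<close> there are at most \<open>p\<^sup>\<ell>\<close> separated points. Conversely the first \<open>p\<^sup>\<ell>\<close> shifts of
  \<open>T(v)\<close> are separated at a frequency of order \<open>(q/p)\<^sup>\<ell>\<close>: a shift by \<open>p\<^sup>t u\<close> with \<open>p\<close> not dividing
  \<open>u\<close> is detected in the letters filled in at level \<open>t + 1\<close>. So the amorphic complexity is
  \<open>ln p / (ln p - ln q)\<close>, and \<open>p = 2\<^sup>n\<close>, \<open>q = 2\<^sup>m\<^sup>+\<^sup>1 - 1\<close> already give a dense set of values.
\<close>

section \<open>Holes of a periodic word\<close>

lemma holes_below_0 [simp]: "holes_below v 0 = 0"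
  by (simp add: holes_below_def)

lemma holes_below_Suc:
  "holes_below v (Suc k) = holes_below v k + (if periodic_word v k = None then 1 else 0)"
proof -
  have "{j. j < Suc k \<and> periodic_word v j = None} =
    {j. j < k \<and> periodic_word v j = None} \<union> (if periodic_word v k = None then {k} else {})"
    by (auto simp: less_Suc_eq)
  then show ?thesis
    by (simp add: holes_below_def)
qed

lemma holes_below_mult: "holes_below v (length v * s) = holes_below v (length v) * s"
  using holes_below_add[of v 0 s] by simp

lemma bij_betw_holes_below:
  "bij_betw (holes_below v) {k. k < n \<and> periodic_word v k = None} {..<holes_below v n}"
proof (induction n)
  case (Suc n)
  show ?case
  proof (cases "periodic_word v n = None")
    case True
    have "{k. k < Suc n \<and> periodic_word v k = None} =
        {k. k < n \<and> periodic_word v k = None} \<union> {n}"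
      using True by (auto simp: less_Suc_eq)
    moreover have "{..<holes_below v (Suc n)} = {..<holes_below v n} \<union> {holes_below v n}"
      using True by (auto simp: holes_below_Suc)
    ultimately show ?thesis
      using notIn_Un_bij_betw[OF _ _ Suc, of n] by simp
  next
    case False
    then have "{k. k < Suc n \<and> periodic_word v k = None} = {k. k < n \<and> periodic_word v k = None}"
      by (auto simp: less_Suc_eq)
    moreover have "holes_below v (Suc n) = holes_below v n"
      using False by (simp only: holes_below_Suc if_False add_0_right)
    ultimately show ?thesis using Suc by (simp only:)
  qed
qed (simp add: bij_betw_def)

text \<open>The holes in \<open>n\<close> periods are numbered by \<open>holes_below v\<close>
  without gaps, so a property of the index can be counted on the indices themselves. Hole counts and
  disagreement counts pass from one level to the next through this.\<close>

lemma card_holes_pullback: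
  "card {k. k < length v * n \<and> periodic_word v k = None \<and> P (holes_below v k)} =
   card {h. h < holes_below v (length v) * n \<and> P h}"
proof -
  let ?H = "{k. k < length v * n \<and> periodic_word v k = None}"
  have bij: "bij_betw (holes_below v) ?H {..<holes_below v (length v) * n}"
    using bij_betw_holes_below[of v "length v * n"] by (simp add: holes_below_mult)
  have "bij_betw (holes_below v) {k \<in> ?H. P (holes_below v k)}
      {h \<in> {..<holes_below v (length v) * n}. P h}"
    using bij unfolding bij_betw_def by (auto simp: inj_on_def)
  then have "card {k \<in> ?H. P (holes_below v k)} = card {h \<in> {..<holes_below v (length v) * n}. P h}"
    by (rule bij_betw_same_card)
  then show ?thesis by (simp add: conj_assoc)
qed

text \<open>A position is a hole at level \<open>l + 1\<close> iff it is a hole of \<open>v\<close>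
  whose index is a hole at level \<open>l\<close>. The free factor \<open>s\<close> absorbs the
  \<open>q\<close> that passing to indices produces.\<close>

lemma card_holes_toeplitz_approx:
  "card {k. k < length v ^ l * s \<and> toeplitz_approx v l k = None} =
   holes_below v (length v) ^ l * s"
proof (induction l arbitrary: s)
  case (Suc l)
  have "{k. k < length v ^ Suc l * s \<and> toeplitz_approx v (Suc l) k = None} =
      {k. k < length v * (length v ^ l * s) \<and> periodic_word v k = None \<and>
          toeplitz_approx v l (holes_below v k) = None}"
    by (auto simp: fill_holes_def mult.assoc split: option.splits)
  then have "card {k. k < length v ^ Suc l * s \<and> toeplitz_approx v (Suc l) k = None} =
      card {h. h < holes_below v (length v) * (length v ^ l * s) \<and> toeplitz_approx v l h = None}"
    by (simp only: card_holes_pullback[where P = "\<lambda>h. toeplitz_approx v l h = None"])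
  also have "\<dots> = holes_below v (length v) ^ l * (holes_below v (length v) * s)"
    unfolding Suc[symmetric] by (simp add: ac_simps)
  finally show ?case by (simp add: ac_simps)
qed simp

section \<open>The metric of a subshift\<close>

lemma mdist_subshift_metric [simp]: "mdist (subshift_metric \<omega>) = seq_dist"
  by (simp add: subshift_metric_def)

lemma mspace_subshift_metric [simp]: "mspace (subshift_metric \<omega>) = shift_orbit_closure \<omega>"
  by (simp add: subshift_metric_def)

lemma funpow_shift: "(shift ^^ n) x = (\<lambda>k. x (k + n))"
  by (induction n) (auto simp: shift_def)

lemma seq_dist_ge_1_iff: "1 \<le> seq_dist x y \<longleftrightarrow> x 0 \<noteq> y 0"
proof
  assume ge: "1 \<le> seq_dist x y"
  then have "x \<noteq> y" by (auto simp: seq_dist_def)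
  then have ex: "\<exists>k. x k \<noteq> y k" by blast
  have "(LEAST k. x k \<noteq> y k) = 0"
  proof (rule ccontr)
    assume "(LEAST k. x k \<noteq> y k) \<noteq> 0"
    then have "(1 / 2 :: real) ^ (LEAST k. x k \<noteq> y k) < 1"
      by (simp add: power_less_one_iff)
    with ge \<open>x \<noteq> y\<close> show False by (simp add: seq_dist_def)
  qed
  with LeastI_ex[OF ex] show "x 0 \<noteq> y 0" by simp
next
  assume "x 0 \<noteq> y 0"
  then have "(LEAST k. x k \<noteq> y k) = 0" "x \<noteq> y" by auto
  then show "1 \<le> seq_dist x y" by (simp add: seq_dist_def)
qed

lemma seq_dist_less_imp_eq:
  assumes "seq_dist x y < (1 / 2) ^ m" "k \<le> m"
  shows "x k = y k"
proof (rule ccontr)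
  assume ne: "x k \<noteq> y k"
  then have "(LEAST k. x k \<noteq> y k) \<le> m"
    using assms(2) Least_le[of "\<lambda>k. x k \<noteq> y k" k] by linarith
  then have "(1 / 2 :: real) ^ m \<le> (1 / 2) ^ (LEAST k. x k \<noteq> y k)"
    by (rule power_decreasing) simp_all
  moreover have "x \<noteq> y" using ne by blast
  ultimately show False using assms(1) by (simp add: seq_dist_def)
qed

lemma less_seq_dist_imp_neq:
  assumes "(1 / 2) ^ m < seq_dist x y"
  shows "\<exists>k<m. x k \<noteq> y k"
proof -
  have "x \<noteq> y" using assms by (auto simp: seq_dist_def)
  then have ex: "\<exists>k. x k \<noteq> y k" by blast
  have "(1 / 2 :: real) ^ m < (1 / 2) ^ (LEAST k. x k \<noteq> y k)"
    using assms \<open>x \<noteq> y\<close> by (simp add: seq_dist_def)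
  then have "(LEAST k. x k \<noteq> y k) < m"
    by (simp add: power_strict_decreasing_iff)
  with LeastI_ex[OF ex] show ?thesis by blast
qed

text \<open>A ball of radius \<open>(1 / 2) ^ m\<close> fixes the coordinates up to
  \<open>m\<close>, and it contains a shift of \<open>\<omega>\<close>. The shift depends on
  \<open>m\<close>.\<close>

lemma shift_orbit_closureD:
  assumes "x \<in> shift_orbit_closure \<omega>"
  shows "\<exists>n. \<forall>k\<le>m. x k = \<omega> (k + n)"
proof -
  interpret Metric_space UNIV "seq_dist :: (nat \<Rightarrow> 'a) \<Rightarrow> _"
    by (rule Metric_space_seq_dist)
  have "x \<in> mtopology closure_of range (\<lambda>n. (shift ^^ n) \<omega>)"
    using assms by (simp add: shift_orbit_closure_def mtopology_of_def)
  then have "\<exists>n. (shift ^^ n) \<omega> \<in> mball x ((1 / 2) ^ m)"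
    unfolding metric_closure_of by force
  then obtain n where "seq_dist x ((shift ^^ n) \<omega>) < (1 / 2) ^ m"
    by auto
  from seq_dist_less_imp_eq[OF this] show ?thesis
    by (auto simp: funpow_shift)
qed

lemma shift_in_shift_orbit_closure: "(shift ^^ n) \<omega> \<in> shift_orbit_closure \<omega>"
proof -
  interpret Metric_space UNIV "seq_dist :: (nat \<Rightarrow> 'a) \<Rightarrow> _"
    by (rule Metric_space_seq_dist)
  have "range (\<lambda>n. (shift ^^ n) \<omega>) \<subseteq> mtopology closure_of range (\<lambda>n. (shift ^^ n) \<omega>)"
    by (rule closure_of_subset) simp
  then show ?thesis
    by (auto simp: shift_orbit_closure_def mtopology_of_def)
qed

text \<open>Distance at least 1 means different first letters, so at this scale separation is plain
  counting of disagreements. The lower bound works at this scale only.\<close>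

lemma separation_count_one:
  "separation_count (subshift_metric \<omega>) shift 1 x y n = card {k. k < n \<and> x k \<noteq> y k}"
  by (simp add: separation_count_def seq_dist_ge_1_iff funpow_shift)

text \<open>A time \<open>k\<close> is counted only if there is a disagreement at some
  \<open>j + k\<close> with \<open>j < m\<close>, so each disagreement accounts for at most
  \<open>m\<close> times.\<close>

lemma separation_count_le:
  assumes "(1 / 2) ^ m < \<delta>"
  shows "separation_count (subshift_metric \<omega>) shift \<delta> x y n \<le>
    m * card {k. k < n + m \<and> x k \<noteq> y k}"
proof -
  let ?E = "{k. k < n + m \<and> x k \<noteq> y k}"
  have "{k. k < n \<and> \<delta> \<le> seq_dist ((shift ^^ k) x) ((shift ^^ k) y)} \<subseteq>
      (\<lambda>(j, k). k - j) ` ({..<m} \<times> ?E)"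
  proof
    fix k assume "k \<in> {k. k < n \<and> \<delta> \<le> seq_dist ((shift ^^ k) x) ((shift ^^ k) y)}"
    then have "k < n" and "(1 / 2) ^ m < seq_dist ((shift ^^ k) x) ((shift ^^ k) y)"
      using assms by auto
    from less_seq_dist_imp_neq[OF this(2)] obtain j where "j < m" "x (j + k) \<noteq> y (j + k)"
      by (auto simp: funpow_shift)
    with \<open>k < n\<close> have "(j, j + k) \<in> {..<m} \<times> ?E" by auto
    moreover have "k = (\<lambda>(j, k). k - j) (j, j + k)" by simp
    ultimately show "k \<in> (\<lambda>(j, k). k - j) ` ({..<m} \<times> ?E)" by (rule rev_image_eqI)
  qed
  then have "separation_count (subshift_metric \<omega>) shift \<delta> x y n \<le> card ({..<m} \<times> ?E)"
    unfolding separation_count_def mdist_subshift_metric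
    by (rule surj_card_le[rotated]) simp
  then show ?thesis by (simp add: card_cartesian_product)
qed

section \<open>Bounding the amorphic complexity\<close>

lemma ln_enat_mono:
  assumes "m \<le> n"
  shows "ln_enat m \<le> ln_enat n"
  using assms by (cases m; cases n) (auto simp: ln_enat_def)

lemma separation_number_ge:
  assumes "separated_set m f \<delta> \<nu> S" "finite S"
  shows "enat (card S) \<le> separation_number m f \<delta> \<nu>"
  unfolding separation_number_def using assms by (intro Sup_upper) auto

lemma separation_number_le:
  assumes "\<And>S. separated_set m f \<delta> \<nu> S \<Longrightarrow> finite S \<and> card S \<le> c"
  shows "separation_number m f \<delta> \<nu> \<le> enat c"
  unfolding separation_number_def using assms by (intro Sup_least) auto

lemma eventually_neg_ln_gt: "eventually (\<lambda>\<nu>::real. 0 < \<nu> \<and> K < - ln \<nu>) (at_right 0)"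
proof -
  have "eventually (\<lambda>\<nu>::real. ln \<nu> < - K) (at_right 0)"
    using ln_at_0 by (auto simp: filterlim_at_bot_dense)
  moreover have "eventually (\<lambda>\<nu>::real. 0 < \<nu>) (at_right 0)"
    by (simp add: eventually_at_right_less)
  ultimately show ?thesis by eventually_elim auto
qed

lemma ereal_divide_pos: "0 < y \<Longrightarrow> ereal x / ereal y = ereal (x / y)"
  by simp

text \<open>Rounding to an integer level and the constant \<open>C\<close> in the next two bounds
  only contribute an additive \<open>d\<close>, which disappears in the limit.\<close>

lemma affine_over_neg_ln_tendsto:
  "((\<lambda>\<nu>::real. ereal (c * (- ln \<nu> + d) / (- ln \<nu>))) \<longlongrightarrow> ereal c) (at_right 0)"
proof -
  have "filterlim (\<lambda>\<nu>::real. - ln \<nu>) at_top (at_right 0)"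
    using ln_at_0 by (simp add: filterlim_uminus_at_top)
  then have "((\<lambda>\<nu>::real. c + c * d / (- ln \<nu>)) \<longlongrightarrow> c + 0) (at_right 0)"
    by (intro tendsto_add tendsto_const tendsto_divide_0[where c = "c * d"] filterlim_at_top_imp_at_infinity)
  moreover have "c + c * d / t = c * (t + d) / t" if "0 < t" for t
    using that by (simp add: field_simps)
  then have "eventually (\<lambda>\<nu>::real. c + c * d / (- ln \<nu>) = c * (- ln \<nu> + d) / (- ln \<nu>)) (at_right 0)"
    using eventually_neg_ln_gt[of 0] by (rule eventually_mono[rotated]) blast
  ultimately have "((\<lambda>\<nu>::real. c * (- ln \<nu> + d) / (- ln \<nu>)) \<longlongrightarrow> c) (at_right 0)"
    by (simp add: filterlim_cong)
  then show ?thesis by (rule tendsto_ereal)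
qed

text \<open>For given \<open>\<nu>\<close> the bound is used at the largest \<open>l\<close> with
  \<open>\<nu> \<le> C * r ^ l\<close>, which is \<open>- ln \<nu> / - ln r\<close> up to a bounded
  error. One \<open>\<delta>\<close> suffices because the complexity is a supremum over
  \<open>\<delta>\<close>.\<close>

lemma lower_amorphic_complexity_ge:
  fixes r :: real and b :: nat
  assumes "0 < \<delta>" "0 < C" "0 < r" "r < 1" "2 \<le> b"
    and sep: "\<And>l \<nu>. 0 < \<nu> \<Longrightarrow> \<nu> \<le> C * r ^ l \<Longrightarrow> enat (b ^ l) \<le> separation_number m f \<delta> \<nu>"
  shows "ereal (ln b / - ln r) \<le> lower_amorphic_complexity m f"
proof -
  define L where "L = - ln r"
  have L: "0 < L" using assms by (simp add: L_def)
  have lnb: "0 < ln (real b)" using assms by simp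
  let ?c = "ln b / L"
  let ?F = "\<lambda>\<nu>. ln_enat (separation_number m f \<delta> \<nu>) / ereal (- ln \<nu>)"
  have "eventually (\<lambda>\<nu>. ereal (?c * (- ln \<nu> + (ln C - L)) / (- ln \<nu>)) \<le> ?F \<nu>) (at_right 0)"
    \<comment> \<open>The bound \<open>- ln C\<close> keeps the argument of \<open>nat\<close> below
      nonnegative; the bound 0 makes the denominator positive.\<close>
    using eventually_neg_ln_gt[of "max 0 (- ln C)"]
  proof eventually_elim
    case (elim \<nu>)
    define l where "l = nat \<lfloor>(- ln \<nu> + ln C) / L\<rfloor>"
    have nonneg: "0 \<le> (- ln \<nu> + ln C) / L" using elim L by simp
    have l: "real l \<le> (- ln \<nu> + ln C) / L" "(- ln \<nu> + ln C) / L - 1 \<le> real l"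
      using nonneg unfolding l_def by linarith+
    have "l * L \<le> - ln \<nu> + ln C" using l(1) L by (simp add: pos_le_divide_eq)
    then have "ln \<nu> \<le> ln (C * r ^ l)"
      using assms by (simp add: ln_mult ln_realpow L_def)
    then have "\<nu> \<le> C * r ^ l" using assms elim by simp
    then have "ln_enat (enat (b ^ l)) \<le> ln_enat (separation_number m f \<delta> \<nu>)"
      using sep elim by (intro ln_enat_mono) auto
    moreover have "ln_enat (enat (b ^ l)) = ereal (l * ln b)"
      using assms by (simp add: ln_enat_def ln_realpow)
    moreover have "?c * (- ln \<nu> + (ln C - L)) = ((- ln \<nu> + ln C) / L - 1) * ln b"
      using L by (simp add: field_simps)
    then have "?c * (- ln \<nu> + (ln C - L)) \<le> l * ln b"
      using l(2) lnb by (metis mult_right_mono less_imp_le)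
    ultimately have "ereal (?c * (- ln \<nu> + (ln C - L))) \<le> ln_enat (separation_number m f \<delta> \<nu>)"
      by (metis ereal_less_eq(3) order_trans)
    then have "ereal (?c * (- ln \<nu> + (ln C - L))) / ereal (- ln \<nu>) \<le> ?F \<nu>"
      using elim by (intro ereal_divide_right_mono) auto
    moreover have "0 < - ln \<nu>" using elim by linarith
    ultimately show ?case by (simp only: ereal_divide_pos)
  qed
  then have "Liminf (at_right 0) (\<lambda>\<nu>. ereal (?c * (- ln \<nu> + (ln C - L)) / (- ln \<nu>))) \<le>
      Liminf (at_right 0) ?F"
    by (rule Liminf_mono)
  also have "Liminf (at_right 0) (\<lambda>\<nu>. ereal (?c * (- ln \<nu> + (ln C - L)) / (- ln \<nu>))) = ereal ?c"
    by (intro lim_imp_Liminf affine_over_neg_ln_tendsto) simp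
  also have "Liminf (at_right 0) ?F \<le> lower_amorphic_complexity m f"
    unfolding lower_amorphic_complexity_def using assms by (intro SUP_upper) auto
  finally show ?thesis by (simp add: L_def)
qed

text \<open>Dual to the lower bound. \<open>C\<close> may depend on \<open>\<delta>\<close>, since
  it does not affect the limit.\<close>

lemma upper_amorphic_complexity_le:
  fixes r :: real and b :: nat
  assumes "0 < r" "r < 1" "2 \<le> b"
    and sep: "\<And>\<delta>. 0 < \<delta> \<Longrightarrow>
      \<exists>C>0. \<forall>l \<nu>. C * r ^ l < \<nu> \<longrightarrow> separation_number m f \<delta> \<nu> \<le> enat (b ^ l)"
  shows "upper_amorphic_complexity m f \<le> ereal (ln b / - ln r)"
  unfolding upper_amorphic_complexity_def
proof (rule SUP_least)
  fix \<delta> :: real assume "\<delta> \<in> {0<..}"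
  then obtain C where C: "0 < C"
    and le: "\<And>l \<nu>. C * r ^ l < \<nu> \<Longrightarrow> separation_number m f \<delta> \<nu> \<le> enat (b ^ l)"
    using sep[of \<delta>] by (metis greaterThan_iff)
  define L where "L = - ln r"
  have L: "0 < L" using assms by (simp add: L_def)
  have lnb: "0 < ln (real b)" using assms by simp
  let ?c = "ln b / L"
  let ?F = "\<lambda>\<nu>. ln_enat (separation_number m f \<delta> \<nu>) / ereal (- ln \<nu>)"
  have "eventually (\<lambda>\<nu>. ?F \<nu> \<le> ereal (?c * (- ln \<nu> + (ln C + L)) / (- ln \<nu>))) (at_right 0)"
    using eventually_neg_ln_gt[of "max 0 (- ln C)"]
  proof eventually_elim
    case (elim \<nu>)
    \<comment> \<open>The \<open>+ 1\<close> yields the least level satisfying the strict inequality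
      \<open>C * r ^ l < \<nu>\<close>.\<close>
    define l where "l = nat \<lfloor>(- ln \<nu> + ln C) / L\<rfloor> + 1"
    have nonneg: "0 \<le> (- ln \<nu> + ln C) / L" using elim L by simp
    have l: "(- ln \<nu> + ln C) / L < real l" "real l \<le> (- ln \<nu> + ln C) / L + 1"
      using nonneg unfolding l_def by linarith+
    have "- ln \<nu> + ln C < l * L" using l(1) L by (simp add: pos_divide_less_eq)
    then have "ln (C * r ^ l) < ln \<nu>"
      using assms C by (simp add: ln_mult ln_realpow L_def)
    then have "C * r ^ l < \<nu>" using assms C elim by simp
    then have "ln_enat (separation_number m f \<delta> \<nu>) \<le> ln_enat (enat (b ^ l))"
      by (intro ln_enat_mono le)
    moreover have "ln_enat (enat (b ^ l)) = ereal (l * ln b)"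
      using assms by (simp add: ln_enat_def ln_realpow)
    moreover have "?c * (- ln \<nu> + (ln C + L)) = ((- ln \<nu> + ln C) / L + 1) * ln b"
      using L by (simp add: field_simps)
    then have "l * ln b \<le> ?c * (- ln \<nu> + (ln C + L))"
      using l(2) lnb by (metis mult_right_mono less_imp_le)
    ultimately have "ln_enat (separation_number m f \<delta> \<nu>) \<le> ereal (?c * (- ln \<nu> + (ln C + L)))"
      by (metis ereal_less_eq(3) order_trans)
    then have "?F \<nu> \<le> ereal (?c * (- ln \<nu> + (ln C + L))) / ereal (- ln \<nu>)"
      using elim by (intro ereal_divide_right_mono) auto
    moreover have "0 < - ln \<nu>" using elim by linarith
    ultimately show ?case by (simp only: ereal_divide_pos)
  qed
  then have "Limsup (at_right 0) ?F \<le>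
      Limsup (at_right 0) (\<lambda>\<nu>. ereal (?c * (- ln \<nu> + (ln C + L)) / (- ln \<nu>)))"
    by (rule Limsup_mono)
  also have "\<dots> = ereal ?c"
    by (intro lim_imp_Limsup affine_over_neg_ln_tendsto) simp
  finally show "Limsup (at_right 0) ?F \<le> ereal (ln b / - ln r)"
    by (simp add: L_def)
qed

lemma lower_le_upper_amorphic_complexity:
  "lower_amorphic_complexity m f \<le> upper_amorphic_complexity m f"
  unfolding lower_amorphic_complexity_def upper_amorphic_complexity_def
  by (intro SUP_mono') (simp add: Liminf_le_Limsup)

section \<open>Toeplitz words\<close>

locale toeplitz_word =
  fixes v :: "'a option list" and \<omega> :: "nat \<Rightarrow> 'a"
  assumes nonempty: "v \<noteq> []"
    and converges: "eventually (\<lambda>l. toeplitz_approx v l k = Some (\<omega> k)) sequentially"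
begin

abbreviation "p \<equiv> length v"
abbreviation "q \<equiv> holes_below v (length v)"

lemma p_pos: "0 < p"
  using nonempty by simp

lemma toeplitz_approx_SomeD:
  assumes "toeplitz_approx v l k = Some a"
  shows "\<omega> k = a"
proof -
  have "toeplitz_approx v l' k = Some a" if "l \<le> l'" for l'
    using that by (induction l' rule: dec_induct)
      (auto intro: assms toeplitz_approx_mono simp del: toeplitz_approx.simps)
  then have "eventually (\<lambda>l'. toeplitz_approx v l' k = Some a) sequentially"
    by (auto simp: eventually_sequentially)
  with converges[of k] have "eventually (\<lambda>l'. \<omega> k = a) sequentially"
    by eventually_elim simp
  then show ?thesis by simp
qed

lemma word_at_letter: "periodic_word v k = Some a \<Longrightarrow> \<omega> k = a"
  by (rule toeplitz_approx_SomeD[of "Suc 0"]) (simp add: fill_holes_def)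

text \<open>With \<open>word_at_letter\<close> this is the self-similarity of
  \<open>\<omega>\<close>: filling the holes of \<open>v\<close> with \<open>\<omega>\<close> gives
  \<open>\<omega>\<close> back.\<close>

lemma word_at_hole:
  assumes "periodic_word v k = None"
  shows "\<omega> k = \<omega> (holes_below v k)"
proof -
  obtain l where "toeplitz_approx v l (holes_below v k) = Some (\<omega> (holes_below v k))"
    using converges[of "holes_below v k"] by (auto simp: eventually_sequentially)
  with assms have "toeplitz_approx v (Suc l) k = Some (\<omega> (holes_below v k))"
    by (simp add: fill_holes_def)
  then show ?thesis by (rule toeplitz_approx_SomeD)
qed

section \<open>Upper bound on the separation numbers\<close>

text \<open>There are only finitely many phases \<open>r\<close>. If each failed at some position
  \<open>K r\<close>, a prefix covering all these positions would agree with a shift of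
  \<open>\<omega>\<close> by some \<open>n\<close>, and by periodicity the phase
  \<open>n mod p ^ l\<close> cannot fail there.\<close>

lemma orbit_closure_skeleton:
  assumes "x \<in> shift_orbit_closure \<omega>"
  shows "\<exists>r<p ^ l. \<forall>k a. toeplitz_approx v l (k + r) = Some a \<longrightarrow> x k = a"
proof (rule ccontr)
  assume "\<not> ?thesis"
  then have "\<forall>r<p ^ l. \<exists>k a. toeplitz_approx v l (k + r) = Some a \<and> x k \<noteq> a"
    by blast
  then obtain K where K: "\<And>r. r < p ^ l \<Longrightarrow>
      \<exists>a. toeplitz_approx v l (K r + r) = Some a \<and> x (K r) \<noteq> a"
    by metis
  obtain n where n: "\<And>k. k \<le> Max (K ` {..<p ^ l}) \<Longrightarrow> x k = \<omega> (k + n)"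
    using shift_orbit_closureD[OF assms] by metis
  let ?r = "n mod p ^ l"
  have r: "?r < p ^ l" using nonempty by simp
  then obtain a where a: "toeplitz_approx v l (K ?r + ?r) = Some a" "x (K ?r) \<noteq> a"
    using K by blast
  have "toeplitz_approx v l (K ?r + ?r + p ^ l * (n div p ^ l)) = Some a"
    using a(1) by (simp only: toeplitz_approx_periodic)
  moreover have "K ?r + ?r + p ^ l * (n div p ^ l) = K ?r + n"
    by simp
  ultimately have "\<omega> (K ?r + n) = a"
    by (metis toeplitz_approx_SomeD)
  moreover have "x (K ?r) = \<omega> (K ?r + n)"
    using r by (intro n Max_ge) auto
  ultimately show False using a(2) by simp
qed

text \<open>Points with a common phase can differ only over holes of level \<open>l\<close>, of
  which there are \<open>q ^ l\<close> per period. The summand \<open>p ^ l\<close> pays for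
  rounding \<open>n + r\<close> up to full periods.\<close>

lemma card_disagreements_le:
  assumes "\<And>k a. toeplitz_approx v l (k + r) = Some a \<Longrightarrow> x k = a \<and> y k = a"
  shows "real (card {k. k < n \<and> x k \<noteq> y k}) \<le> (q / p) ^ l * (real n + r + p ^ l)"
proof -
  let ?s = "(n + r) div p ^ l + 1"
  let ?H = "{k. k < p ^ l * ?s \<and> toeplitz_approx v l k = None}"
  have pl: "0 < p ^ l" using nonempty by simp
  have nr: "n + r < p ^ l * ?s"
    using dividend_less_times_div[OF pl, of "n + r"] by simp
  have "(\<lambda>k. k + r) ` {k. k < n \<and> x k \<noteq> y k} \<subseteq> ?H"
  proof (rule image_subsetI)
    fix k assume k: "k \<in> {k. k < n \<and> x k \<noteq> y k}"
    then have "toeplitz_approx v l (k + r) = None"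
      using assms[of k] by (cases "toeplitz_approx v l (k + r)") auto
    moreover have "k + r < p ^ l * ?s" using k nr by auto
    ultimately show "k + r \<in> ?H" by simp
  qed
  then have "card ((\<lambda>k. k + r) ` {k. k < n \<and> x k \<noteq> y k}) \<le> card ?H"
    by (intro card_mono) auto
  moreover have "card ((\<lambda>k. k + r) ` {k. k < n \<and> x k \<noteq> y k}) = card {k. k < n \<and> x k \<noteq> y k}"
    by (intro card_image) (auto simp: inj_on_def)
  ultimately have "card {k. k < n \<and> x k \<noteq> y k} \<le> q ^ l * ?s"
    by (simp only: card_holes_toeplitz_approx)
  then have "real (card {k. k < n \<and> x k \<noteq> y k}) \<le> real q ^ l * real ?s"
    by (metis of_nat_le_iff of_nat_mult of_nat_power)
  also have "real ?s \<le> (real n + r) / p ^ l + 1"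
    using of_nat_div_le_of_nat[where 'a = real, of "n + r" "p ^ l"] by simp
  also have "real q ^ l * ((real n + r) / p ^ l + 1) = (q / p) ^ l * (real n + r + p ^ l)"
    using nonempty by (simp add: field_simps)
  finally show ?thesis by (simp add: mult_left_mono)
qed

text \<open>Two points with the same phase differ too rarely to be separated, so the phase is
  injective on a separated set, and there are \<open>p ^ l\<close> phases.\<close>

lemma separation_number_upper:
  assumes m: "(1 / 2) ^ m < \<delta>" and \<nu>: "m * (q / p) ^ l < \<nu>"
  shows "separation_number (subshift_metric \<omega>) shift \<delta> \<nu> \<le> enat (p ^ l)"
proof (rule separation_number_le)
  fix S assume S: "separated_set (subshift_metric \<omega>) shift \<delta> \<nu> S"
  obtain R where R: "\<And>x. x \<in> S \<Longrightarrow> R x < p ^ l"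
    and skel: "\<And>x k a. x \<in> S \<Longrightarrow> toeplitz_approx v l (k + R x) = Some a \<Longrightarrow> x k = a"
    using S orbit_closure_skeleton[of _ l] unfolding separated_set_def mspace_subshift_metric
    by (metis subsetD)
  have "inj_on R S"
  proof (rule inj_onI, rule ccontr)
    fix x y assume xy: "x \<in> S" "y \<in> S" "R x = R y" "x \<noteq> y"
    let ?D = "real m * (q / p) ^ l"
    let ?c = "\<lambda>n. separation_count (subshift_metric \<omega>) shift \<delta> x y n"
    \<comment> \<open>The error collects the window \<open>m\<close>, the phase \<open>R x\<close>
      and the rounding \<open>p ^ l\<close>; all are constant in \<open>n\<close>.\<close>
    have "(\<lambda>n. ?D + ?D * (m + R x + p ^ l) / real n) \<longlonglongrightarrow> ?D + 0"
      by (intro tendsto_add tendsto_const lim_const_over_n)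
    then have lim: "(\<lambda>n. ereal (?D + ?D * (m + R x + p ^ l) / real n)) \<longlonglongrightarrow> ereal ?D"
      by simp
    have "ereal (real (?c n) / real n) \<le> ereal (?D + ?D * (m + R x + p ^ l) / real n)"
      if "n > 0" for n
    proof -
      have "real (?c n) \<le> real m * real (card {k. k < n + m \<and> x k \<noteq> y k})"
        using separation_count_le[OF m] by (metis of_nat_le_iff of_nat_mult)
      also have "\<dots> \<le> real m * ((q / p) ^ l * (real (n + m) + R x + p ^ l))"
        using skel xy by (intro mult_left_mono card_disagreements_le) auto
      also have "\<dots> = ?D * (real n + (m + R x + p ^ l))"
        by (simp add: algebra_simps)
      also have "\<dots> = (?D + ?D * (m + R x + p ^ l) / real n) * n"
        using that unfolding distrib_left[of ?D] distrib_right[of ?D] by simp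
      finally show ?thesis using that by (simp add: pos_divide_le_eq)
    qed
    then have "limsup (\<lambda>n. ereal (real (?c n) / real n)) \<le>
        limsup (\<lambda>n. ereal (?D + ?D * (m + R x + p ^ l) / real n))"
      by (intro Limsup_mono eventually_mono[OF eventually_gt_at_top[of 0]])
    also have "\<dots> = ereal ?D"
      using lim by (intro lim_imp_Limsup) simp_all
    finally have "ereal \<nu> \<le> ereal ?D"
      using S xy unfolding separated_set_def separated_points_def by (meson order_trans)
    with \<nu> show False by simp
  qed
  moreover have "R ` S \<subseteq> {..<p ^ l}" using R by auto
  ultimately show "finite S \<and> card S \<le> p ^ l"
    using inj_on_finite[of R S "{..<p ^ l}"] card_inj_on_le[of R S "{..<p ^ l}"] by simp
qed

end

text \<open>On the subsequence of holes the shift by \<open>p u\<close> acts as the shift by \<open>q u\<close>; coprimality keeps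
  the multiplicity of \<open>p\<close> in \<open>q u\<close> equal to that in \<open>u\<close>.\<close>

locale separating_toeplitz_word = toeplitz_word +
  assumes coprime: "coprime p q"
    and letters_differ: "\<not> p dvd r \<Longrightarrow>
      \<exists>k a b. periodic_word v k = Some a \<and> periodic_word v (k + r) = Some b \<and> a \<noteq> b"
begin

section \<open>Lower bound on the separation numbers\<close>

text \<open>A pair of different letters of \<open>v\<close> at distance \<open>r\<close> recurs in
  every period, and letters of \<open>v\<close> survive in \<open>\<omega>\<close>.\<close>

lemma card_differences_nondvd:
  assumes "\<not> p dvd r"
  shows "s \<le> card {k. k < p * s \<and> \<omega> k \<noteq> \<omega> (k + r)}"
proof -
  obtain k a b where k: "periodic_word v k = Some a" "periodic_word v (k + r) = Some b" "a \<noteq> b"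
    using letters_differ[OF assms] by blast
  let ?k = "\<lambda>i. k mod p + p * i"
  have "?k ` {..<s} \<subseteq> {k. k < p * s \<and> \<omega> k \<noteq> \<omega> (k + r)}"
  proof (rule image_subsetI)
    fix i assume "i \<in> {..<s}"
    then have "i < s" by simp
    have "?k i < p * Suc i" using p_pos by simp
    also have "\<dots> \<le> p * s" using \<open>i < s\<close> by (intro mult_le_mono) auto
    finally have "?k i < p * s" .
    moreover have "periodic_word v (?k i) = Some a"
      using k(1) by (simp add: periodic_word_def)
    moreover have "periodic_word v (?k i + r) = Some b"
    proof -
      have "?k i + r = k mod p + r + p * i" by simp
      then have "(?k i + r) mod p = (k + r) mod p"
        by (simp only: mod_mult_self2 mod_add_left_eq)
      with k(2) show ?thesis by (simp add: periodic_word_def)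
    qed
    ultimately show "?k i \<in> {k. k < p * s \<and> \<omega> k \<noteq> \<omega> (k + r)}"
      using k(3) word_at_letter[of "?k i" a] word_at_letter[of "?k i + r" b] by simp
  qed
  then have "card (?k ` {..<s}) \<le> card {k. k < p * s \<and> \<omega> k \<noteq> \<omega> (k + r)}"
    by (intro card_mono) auto
  moreover have "card (?k ` {..<s}) = s"
    using p_pos by (subst card_image) (auto simp: inj_on_def)
  ultimately show ?thesis by simp
qed

lemma card_differences:
  assumes "\<not> p dvd u"
  shows "q ^ t * s \<le> card {k. k < p ^ Suc t * s \<and> \<omega> k \<noteq> \<omega> (k + p ^ t * u)}"
  using assms
proof (induction t arbitrary: u s)
  case 0
  then show ?case using card_differences_nondvd by simp
next
  case (Suc t)
  let ?P = "\<lambda>h. \<omega> h \<noteq> \<omega> (h + p ^ t * (q * u))"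
  have "\<not> p dvd q * u"
    using Suc.prems coprime by (simp add: coprime_dvd_mult_right_iff)
  \<comment> \<open>Passing to the holes multiplies both the shift and the number of periods by
    \<open>q\<close>, so both \<open>u\<close> and \<open>s\<close> must be free in the
    induction.\<close>
  from Suc.IH[OF this, of "q * s"]
  have "q ^ Suc t * s \<le> card {h. h < q * (p ^ Suc t * s) \<and> ?P h}"
    by (simp add: ac_simps)
  also have "\<dots> = card {k. k < p * (p ^ Suc t * s) \<and> periodic_word v k = None \<and> ?P (holes_below v k)}"
    by (rule card_holes_pullback[symmetric])
  also have "\<dots> \<le> card {k. k < p ^ Suc (Suc t) * s \<and> \<omega> k \<noteq> \<omega> (k + p ^ Suc t * u)}"
  proof (rule card_mono, simp, clarify)
    fix k assume k: "k < p * (p ^ Suc t * s)" "periodic_word v k = None" "?P (holes_below v k)"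
    have eq: "k + p ^ Suc t * u = k + p * (p ^ t * u)" by simp
    have "periodic_word v (k + p ^ Suc t * u) = None"
      unfolding eq periodic_word_add by (rule k)
    then have "\<omega> (k + p ^ Suc t * u) = \<omega> (holes_below v (k + p ^ Suc t * u))"
      by (rule word_at_hole)
    also have "holes_below v (k + p ^ Suc t * u) = holes_below v k + p ^ t * (q * u)"
      unfolding eq holes_below_add by (simp add: ac_simps)
    finally show "k < p ^ Suc (Suc t) * s \<and> \<omega> k \<noteq> \<omega> (k + p ^ Suc t * u)"
      using k word_at_hole[OF k(2)] by (simp add: mult.assoc)
  qed
  finally show ?case .
qed

text \<open>Write \<open>j - i = p ^ t * u\<close> with \<open>p\<close> not dividing
  \<open>u\<close>. Then \<open>t < l\<close>, and the frequency of differences is at least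
  \<open>q ^ t / p ^ Suc t\<close>, that is \<open>1 / q * (q / p) ^ Suc t\<close>; this explains
  the factor \<open>1 / q\<close>.\<close>

lemma separated_shifts:
  assumes "i < j" "j < p ^ l" "1 \<le> q" "q < p" "\<nu> \<le> 1 / q * (q / p) ^ l"
  shows "separated_points (subshift_metric \<omega>) shift 1 \<nu> ((shift ^^ i) \<omega>) ((shift ^^ j) \<omega>)"
proof -
  let ?c = "\<lambda>n. separation_count (subshift_metric \<omega>) shift 1 ((shift ^^ i) \<omega>) ((shift ^^ j) \<omega>) n"
  have "2 \<le> p" using assms by simp
  obtain t u where tu: "j - i = p ^ t * u" "\<not> p dvd u"
  proof -
    have "j - i \<noteq> 0" "\<not> is_unit p" using assms(1) \<open>2 \<le> p\<close> by auto
    from multiplicity_decompose'[OF this] show ?thesis using that by blast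
  qed
  have "u > 0" using tu by (metis dvd_0_right gr0I)
  have "p ^ t \<le> p ^ t * u" using \<open>u > 0\<close> by simp
  also have "\<dots> < p ^ l" using assms tu(1) by linarith
  finally have "t < l" using \<open>2 \<le> p\<close> by simp
  let ?D = "real q ^ t / p ^ Suc t"
  \<comment> \<open>The loss \<open>q ^ t\<close> comes from the incomplete last period, the loss
    \<open>i\<close> from positions before the first shift.\<close>
  have "(\<lambda>n. ?D + - (real q ^ t + i) / real n) \<longlonglongrightarrow> ?D + 0"
    by (intro tendsto_add tendsto_const lim_const_over_n)
  then have lim: "(\<lambda>n. ereal (?D + - (real q ^ t + i) / real n)) \<longlonglongrightarrow> ereal ?D"
    by simp
  have "ereal (?D + - (real q ^ t + i) / real n) \<le> ereal (real (?c n) / real n)" if "n > 0" for n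
  proof -
    let ?N = "{k. k < n \<and> \<omega> k \<noteq> \<omega> (k + (j - i))}"
    let ?M = "{k. k < n \<and> \<omega> (k + i) \<noteq> \<omega> (k + j)}"
    let ?s = "n div p ^ Suc t"
    have "?N \<subseteq> {..<i} \<union> (\<lambda>k. k + i) ` ?M"
    proof
      fix k assume k: "k \<in> ?N"
      show "k \<in> {..<i} \<union> (\<lambda>k. k + i) ` ?M"
      proof (cases "k < i")
        case False
        with k assms(1) have "k - i \<in> ?M" "k = (k - i) + i" by auto
        then show ?thesis by blast
      qed simp
    qed
    then have "card ?N \<le> card ({..<i} \<union> (\<lambda>k. k + i) ` ?M)"
      by (intro card_mono) auto
    also have "\<dots> \<le> i + card ?M"
      using card_Un_le[of "{..<i}" "(\<lambda>k. k + i) ` ?M"] card_image_le[of ?M "\<lambda>k. k + i"] by simp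
    also have "card ?M = ?c n"
      by (simp add: separation_count_one funpow_shift)
    finally have N: "card ?N \<le> i + ?c n" .
    have "q ^ t * ?s \<le> card {k. k < p ^ Suc t * ?s \<and> \<omega> k \<noteq> \<omega> (k + (j - i))}"
      unfolding tu(1) by (rule card_differences[OF tu(2)])
    also have "\<dots> \<le> card ?N"
      by (intro card_mono) (auto intro: less_le_trans simp del: power_Suc)
    finally have "q ^ t * ?s \<le> i + ?c n" using N by simp
    then have le: "real q ^ t * real ?s \<le> i + real (?c n)"
      by (metis of_nat_le_iff of_nat_mult of_nat_power of_nat_add)
    have "real n / real (p ^ Suc t) - 1 \<le> real ?s"
    proof -
      have "real ?s = \<lfloor>real n / real (p ^ Suc t)\<rfloor>"
        by (simp only: floor_divide_of_nat_eq of_int_of_nat_eq)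
      then show ?thesis by linarith
    qed
    then have "real q ^ t * (real n / real (p ^ Suc t) - 1) \<le> real q ^ t * real ?s"
      by (intro mult_left_mono) auto
    with le have "?D * n - real q ^ t - i \<le> real (?c n)"
      by (simp add: algebra_simps)
    moreover have "?D + - (real q ^ t + i) / real n = (?D * n - real q ^ t - i) / n"
      using that by (simp add: field_simps)
    ultimately show ?thesis by (simp add: divide_right_mono)
  qed
  then have le: "limsup (\<lambda>n. ereal (?D + - (real q ^ t + i) / real n)) \<le>
      limsup (\<lambda>n. ereal (real (?c n) / real n))"
    by (intro Limsup_mono eventually_mono[OF eventually_gt_at_top[of 0]])
  have "\<nu> \<le> ?D"
  proof -
    have "\<nu> \<le> 1 / q * (q / p) ^ l" by (rule assms)
    also have "(q / p) ^ l \<le> (q / p) ^ Suc t"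
      using \<open>t < l\<close> assms(4) by (intro power_decreasing) (auto simp: divide_le_eq_1)
    also have "1 / q * (q / p) ^ Suc t = ?D"
      using assms by (simp add: field_simps)
    finally show ?thesis by (simp add: divide_right_mono)
  qed
  then have "ereal \<nu> \<le> ereal ?D" by simp
  also have "\<dots> = limsup (\<lambda>n. ereal (?D + - (real q ^ t + i) / real n))"
    using lim by (intro lim_imp_Limsup[symmetric]) simp_all
  also note le
  finally show ?thesis unfolding separated_points_def .
qed

lemma separation_number_lower:
  assumes "1 \<le> q" "q < p" "0 < \<nu>" "\<nu> \<le> 1 / q * (q / p) ^ l"
  shows "enat (p ^ l) \<le> separation_number (subshift_metric \<omega>) shift 1 \<nu>"
proof -
  let ?x = "\<lambda>i. (shift ^^ i) \<omega>"
  have sym: "separated_points (subshift_metric \<omega>) shift 1 \<nu> x y \<Longrightarrow>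
      separated_points (subshift_metric \<omega>) shift 1 \<nu> y x" for x y
    by (simp add: separated_points_def separation_count_one eq_commute)
  have sep: "separated_points (subshift_metric \<omega>) shift 1 \<nu> (?x i) (?x j)"
    if "i < p ^ l" "j < p ^ l" "i \<noteq> j" for i j
    using that separated_shifts[of i j l \<nu>] separated_shifts[of j i l \<nu>] sym assms
    by (cases "i < j") (auto simp: neq_iff)
  \<comment> \<open>As \<open>\<nu>\<close> is positive, no point is separated from itself. Hence
    different indices give different points, and the set of shifts has full size
    \<open>p ^ l\<close>.\<close>
  have irrefl: "\<not> separated_points (subshift_metric \<omega>) shift 1 \<nu> x x" for x
    using assms(3) by (simp add: separated_points_def separation_count_one Limsup_const)
  have "inj_on ?x {..<p ^ l}"
    by (rule inj_onI) (metis sep irrefl lessThan_iff)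
  then have "card (?x ` {..<p ^ l}) = p ^ l" by (simp add: card_image)
  moreover have "separated_set (subshift_metric \<omega>) shift 1 \<nu> (?x ` {..<p ^ l})"
    unfolding separated_set_def using sep by (auto simp: shift_in_shift_orbit_closure)
  ultimately show ?thesis
    using separation_number_ge by (metis finite_imageI finite_lessThan)
qed

theorem amorphic_complexity:
  assumes "1 \<le> q" "q < p"
  shows "has_amorphic_complexity (subshift_metric \<omega>) shift (ereal (ln p / (ln p - ln q)))"
proof -
  let ?r = "real q / real p"
  have "0 < real q" "real q < real p" using assms by linarith+
  then have r: "0 < ?r" "?r < 1" by (simp_all only: divide_pos_pos divide_less_eq_1_pos order.strict_trans)
  have p: "2 \<le> p" using assms by linarith
  have L: "- ln ?r = ln p - ln q" using assms by (simp add: ln_div)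
  have "ereal (ln p / - ln ?r) \<le> lower_amorphic_complexity (subshift_metric \<omega>) shift"
    using r p assms
    by (intro lower_amorphic_complexity_ge[where \<delta> = 1 and C = "1 / q"] separation_number_lower) auto
  moreover have "upper_amorphic_complexity (subshift_metric \<omega>) shift \<le> ereal (ln p / - ln ?r)"
  proof (rule upper_amorphic_complexity_le[OF r p])
    fix \<delta> :: real assume "0 < \<delta>"
    then obtain m where m: "(1 / 2) ^ m < \<delta>"
      using real_arch_pow_inv[of \<delta> "1 / 2"] by auto
    \<comment> \<open>Going to \<open>Suc m\<close> ensures that the constant \<open>C\<close>
      chosen below is positive.\<close>
    have "(1 / 2 :: real) ^ Suc m \<le> (1 / 2) ^ m" by simp
    with m have "(1 / 2) ^ Suc m < \<delta>" by linarith
    from separation_number_upper[OF this]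
    show "\<exists>C>0. \<forall>l \<nu>. C * ?r ^ l < \<nu> \<longrightarrow>
        separation_number (subshift_metric \<omega>) shift \<delta> \<nu> \<le> enat (p ^ l)"
      by (intro exI[of _ "real (Suc m)"]) auto
  qed
  ultimately show ?thesis
    using lower_le_upper_amorphic_complexity[of "subshift_metric \<omega>" shift]
    unfolding has_amorphic_complexity_def L by (metis antisym order_trans)
qed

end

section \<open>The words \<open>a b\<^sup>p\<^sup>-\<^sup>q\<^sup>-\<^sup>1 \<ast>\<^sup>q\<close>\<close>

text \<open>The word starts with a letter, so that every position is eventually filled. For
  \<open>a\<close> different from \<open>b\<close> the letter \<open>a\<close> marks the start of
  each period, which lets shifts be detected.\<close>

definition block_word :: "'a \<Rightarrow> 'a \<Rightarrow> nat \<Rightarrow> nat \<Rightarrow> 'a option list" where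
  "block_word a b p q = Some a # replicate (p - q - 1) (Some b) @ replicate q None"

lemma length_block_word: "q < p \<Longrightarrow> length (block_word a b p q) = p"
  by (simp add: block_word_def)

lemma nth_block_word:
  assumes "q < p" "i < p"
  shows "block_word a b p q ! i = (if i = 0 then Some a else if i < p - q then Some b else None)"
  using assms by (auto simp: block_word_def nth_Cons nth_append split: nat.split)

lemma holes_below_block_word:
  assumes "q < p"
  shows "holes_below (block_word a b p q) p = q"
proof -
  have "{j. j < p \<and> periodic_word (block_word a b p q) j = None} = {p - q..<p}"
    using assms by (auto simp: periodic_word_def length_block_word nth_block_word split: if_splits)
  then show ?thesis using assms by (simp add: holes_below_def)
qed

text \<open>Position 0 is a letter, so a hole at \<open>k\<close> has index less than
  \<open>k\<close>, and its filling is settled by strong induction.\<close>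

lemma toeplitz_approx_converges:
  assumes "periodic_word v 0 \<noteq> None"
  shows "\<exists>c. eventually (\<lambda>l. toeplitz_approx v l k = Some c) sequentially"
proof (induction k rule: less_induct)
  case (less k)
  show ?case
  proof (cases "periodic_word v k")
    case (Some c)
    then have "toeplitz_approx v (Suc l) k = Some c" for l
      by (simp add: fill_holes_def)
    then have "eventually (\<lambda>l. toeplitz_approx v (Suc l) k = Some c) sequentially"
      by simp
    then show ?thesis using eventually_sequentially_Suc by blast
  next
    case None
    have "0 < j" if "periodic_word v j = None" for j
      using assms that by (metis gr0I)
    then have "{j. j < k \<and> periodic_word v j = None} \<subseteq> {0<..<k}"
      by auto
    then have "holes_below v k \<le> card {0<..<k}"
      unfolding holes_below_def by (intro card_mono) auto
    moreover have "k \<noteq> 0" using None assms by metis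
    ultimately have "holes_below v k < k" by simp
    from less[OF this] obtain c where
      "eventually (\<lambda>l. toeplitz_approx v l (holes_below v k) = Some c) sequentially" by blast
    then have "eventually (\<lambda>l. toeplitz_approx v (Suc l) k = Some c) sequentially"
      using None by (simp add: fill_holes_def)
    then show ?thesis using eventually_sequentially_Suc by blast
  qed
qed

text \<open>Either the shift moves the \<open>a\<close> at 0 onto a \<open>b\<close>, or the residue
  of \<open>r\<close> is at least \<open>p - q\<close>. In the second case the position
  \<open>p - r mod p\<close> is at most \<open>q < p - q\<close>, so it carries a \<open>b\<close>,
  which is moved onto an \<open>a\<close>.\<close>

lemma block_word_letters_differ:
  assumes "2 * q + 1 \<le> p" "\<not> p dvd r" "a \<noteq> b"
  shows "\<exists>k c d. periodic_word (block_word a b p q) k = Some c \<and>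
    periodic_word (block_word a b p q) (k + r) = Some d \<and> c \<noteq> d"
proof -
  let ?w = "periodic_word (block_word a b p q)"
  have qp: "q < p" using assms by simp
  have w: "?w k = (if k mod p = 0 then Some a else if k mod p < p - q then Some b else None)" for k
    using qp by (simp add: periodic_word_def length_block_word nth_block_word)
  have r: "r mod p \<noteq> 0" "r mod p < p" using assms(2) qp by (auto simp: dvd_eq_mod_eq_0)
  show ?thesis
  proof (cases "r mod p < p - q")
    case True
    then have "?w 0 = Some a" "?w (0 + r) = Some b" using r by (auto simp: w)
    with assms(3) show ?thesis by blast
  next
    case False
    let ?k = "p - r mod p"
    have "?k < p" "?k < p - q" "?k \<noteq> 0" using r False assms(1) by linarith+
    then have "?w ?k = Some b" by (simp add: w)
    moreover have "(?k + r) mod p = 0"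
      using r(2) by (metis le_add_diff_inverse2 less_imp_le mod_add_right_eq mod_self)
    then have "?w (?k + r) = Some a" by (simp add: w)
    ultimately show ?thesis using assms(3) by metis
  qed
qed

lemma ex_toeplitz_word_amorphic_complexity:
  fixes a b :: 'a and p q :: nat
  assumes "a \<noteq> b" "coprime p q" "1 \<le> q" "2 * q + 1 \<le> p"
  shows "\<exists>q' \<omega> :: nat \<Rightarrow> 'a. is_toeplitz_word p q' \<omega> \<and>
    has_amorphic_complexity (subshift_metric \<omega>) shift (ereal (ln p / (ln p - ln q)))"
proof -
  let ?v = "block_word a b p q"
  have qp: "q < p" using assms by simp
  have "periodic_word ?v 0 \<noteq> None"
    using qp by (simp add: periodic_word_def nth_block_word length_block_word)
  then have "\<forall>k. \<exists>c. eventually (\<lambda>l. toeplitz_approx ?v l k = Some c) sequentially"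
    by (intro allI toeplitz_approx_converges)
  from choice[OF this] obtain \<omega>
    where \<omega>: "\<And>k. eventually (\<lambda>l. toeplitz_approx ?v l k = Some (\<omega> k)) sequentially"
    by blast
  have ne: "?v \<noteq> []" "\<exists>c\<in>set ?v. c \<noteq> None" by (auto simp: block_word_def)
  interpret separating_toeplitz_word ?v \<omega>
  proof (unfold_locales, unfold length_block_word[OF qp] holes_below_block_word[OF qp])
    show "\<exists>k c d. periodic_word ?v k = Some c \<and> periodic_word ?v (k + r) = Some d \<and> c \<noteq> d"
      if "\<not> p dvd r" for r
      using assms(4) that assms(1) by (rule block_word_letters_differ)
  qed (fact ne(1) \<omega> assms(2))+
  have "has_amorphic_complexity (subshift_metric \<omega>) shift (ereal (ln p / (ln p - ln q)))"
    using amorphic_complexity assms(3) qp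
    unfolding length_block_word[OF qp] holes_below_block_word[OF qp] by blast
  moreover have "is_toeplitz_word p (count_list ?v None) \<omega>"
    unfolding is_toeplitz_word_def
    by (intro exI[of _ ?v] conjI allI ne \<omega> length_block_word[OF qp] refl)
  ultimately show ?thesis by blast
qed

section \<open>Density of the values\<close>

text \<open>The ratio is \<open>1 / (1 - y)\<close> with \<open>y = ln q / ln p\<close>, so
  \<open>y\<close> has to tend to \<open>x = 1 - 1 / c\<close>. For \<open>p = 2 ^ n\<close> and
  \<open>q\<close> close to a power of 2, \<open>y\<close> is nearly a quotient of
  exponents.\<close>

lemma dense_log_ratios:
  fixes c :: real
  assumes "1 \<le> c"
  shows "c \<in> closure {ln (real p) / (ln p - ln q) | p q :: nat. coprime p q \<and> 1 \<le> q \<and> 2 * q + 1 \<le> p}"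
    (is "c \<in> closure ?D")
proof -
  define x where "x = 1 - 1 / c"
  have x: "0 \<le> x" "x < 1" using assms by (auto simp: x_def field_simps)
  define m where "m n = nat \<lfloor>x * real n\<rfloor>" for n
  \<comment> \<open>Subtracting 1 makes \<open>q n\<close> odd, hence coprime to
    \<open>2 ^ n\<close>, and keeps it between \<open>2 ^ m n\<close> and
    \<open>2 ^ Suc (m n)\<close>.\<close>
  define q where "q n = (2::nat) ^ Suc (m n) - 1" for n
  have m: "x * n - 1 \<le> m n" "m n \<le> x * n" for n
  proof -
    have "0 \<le> x * n" using x by simp
    then show "x * n - 1 \<le> m n" "m n \<le> x * n" unfolding m_def by linarith+
  qed
  have q: "(2::nat) ^ m n \<le> q n" "q n \<le> 2 ^ Suc (m n)" "1 \<le> q n" "odd (q n)" for n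
  proof -
    have "(1::nat) \<le> 2 ^ m n" by simp
    then show "(2::nat) ^ m n \<le> q n" "q n \<le> 2 ^ Suc (m n)" "1 \<le> q n"
      unfolding q_def power_Suc by linarith+
    show "odd (q n)" by (simp add: q_def)
  qed
  have lnq: "m n * ln 2 \<le> ln (real (q n))" "ln (real (q n)) \<le> (m n + 1) * ln 2" for n
  proof -
    have "real (2 ^ m n) \<le> real (q n)" using q(1) by (rule of_nat_mono)
    then have "ln (real (2 ^ m n)) \<le> ln (real (q n))" using q(3)[of n] by (subst ln_le_cancel_iff) auto
    then show "m n * ln 2 \<le> ln (real (q n))" by (simp add: ln_realpow)
    have "real (q n) \<le> real (2 ^ Suc (m n))" using q(2) by (rule of_nat_mono)
    then have "ln (real (q n)) \<le> ln (real (2 ^ Suc (m n)))" using q(3)[of n] by (subst ln_le_cancel_iff) auto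
    also have "\<dots> = real (Suc (m n)) * ln 2" unfolding of_nat_power by (subst ln_realpow) auto
    finally show "ln (real (q n)) \<le> (m n + 1) * ln 2" by simp
  qed
  let ?y = "\<lambda>n. ln (real (q n)) / ln (real (2 ^ n))"
  have y: "x - 1 / real n \<le> ?y n \<and> ?y n \<le> x + 1 / real n" if "n > 0" for n
  proof -
    have ln2: "0 < ln (2::real)" by simp
    have "(x * n - 1) * ln 2 \<le> ln (real (q n))"
      by (rule order_trans[OF mult_right_mono[OF m(1)] lnq(1)]) simp
    moreover have "ln (real (q n)) \<le> (x * n + 1) * ln 2"
      using m(2)[of n] by (intro order_trans[OF lnq(2)] mult_right_mono) auto
    moreover have "ln (real (2 ^ n)) = n * ln 2" by (simp add: ln_realpow)
    moreover have "x - 1 / n = (x * n - 1) * ln 2 / (n * ln 2)"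
      "x + 1 / n = (x * n + 1) * ln 2 / (n * ln 2)"
      using that ln2 by (simp_all add: field_simps)
    ultimately show ?thesis by (simp only:) (intro conjI divide_right_mono; simp)
  qed
  have "?y \<longlonglongrightarrow> x"
  proof (rule tendsto_sandwich)
    show "\<forall>\<^sub>F n in sequentially. x - 1 / real n \<le> ?y n"
      using eventually_gt_at_top[of 0] by eventually_elim (use y in blast)
    show "\<forall>\<^sub>F n in sequentially. ?y n \<le> x + 1 / real n"
      using eventually_gt_at_top[of 0] by eventually_elim (use y in blast)
    show "(\<lambda>n. x - 1 / real n) \<longlonglongrightarrow> x"
      using tendsto_diff[OF tendsto_const lim_const_over_n[of 1]] by force
    show "(\<lambda>n. x + 1 / real n) \<longlonglongrightarrow> x"
      using tendsto_add[OF tendsto_const lim_const_over_n[of 1]] by force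
  qed
  then have "(\<lambda>n. 1 / (1 - ?y n)) \<longlonglongrightarrow> 1 / (1 - x)"
    using x by (intro tendsto_intros) auto
  moreover have "1 / (1 - x) = c" using assms by (simp add: x_def)
  ultimately have lim: "(\<lambda>n. 1 / (1 - ?y n)) \<longlonglongrightarrow> c" by simp
  \<comment> \<open>Since \<open>x < 1\<close>, eventually \<open>m n + 2 \<le> n\<close>, which is
    exactly the room needed for \<open>2 * q n + 1 \<le> 2 ^ n\<close>.\<close>
  have "filterlim (\<lambda>n. (1 - x) * real n) at_top sequentially"
    using x by (intro filterlim_tendsto_pos_mult_at_top[OF tendsto_const _ filterlim_real_sequentially]) auto
  then have "eventually (\<lambda>n. 2 \<le> (1 - x) * real n) sequentially"
    by (simp add: filterlim_at_top)
  then have "eventually (\<lambda>n. 1 / (1 - ?y n) \<in> ?D) sequentially"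
    using eventually_gt_at_top[of 0]
  proof eventually_elim
    case (elim n)
    then have "real (m n) + 2 \<le> n" using m(2)[of n] by (simp add: algebra_simps)
    then have "m n + 2 \<le> n" by linarith
    then have "(2::nat) ^ (m n + 2) \<le> 2 ^ n" by (intro power_increasing) auto
    moreover have "q n + 1 = 2 * 2 ^ m n" by (simp add: q_def)
    ultimately have le: "2 * q n + 1 \<le> 2 ^ n" unfolding power_add by simp
    have "coprime (2 ^ n) (q n)" using q(4) by simp
    moreover have "1 / (1 - ?y n) = ln (real (2 ^ n)) / (ln (real (2 ^ n)) - ln (real (q n)))"
      using elim by (simp add: field_simps ln_realpow)
    ultimately show ?case using le q(3) by blast
  qed
  then have "eventually (\<lambda>n. 1 / (1 - ?y n) \<in> closure ?D) sequentially"
    by (rule eventually_mono) (rule subsetD[OF closure_subset])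
  from Lim_in_closed_set[OF closed_closure this _ lim] show ?thesis by simp
qed

theorem corollary5p7:
  assumes "CARD('a::finite) \<ge> 2"
  shows "\<exists>D. D \<subseteq> {1..} \<and> {1..} \<subseteq> closure D \<and>
    D \<subseteq> {a::real. \<exists>p q. \<exists>\<omega> :: nat \<Rightarrow> 'a. is_toeplitz_word p q \<omega> \<and>
           has_amorphic_complexity (subshift_metric \<omega>) shift (ereal a)}"
proof -
  let ?D = "{ln (real p) / (ln p - ln q) | p q :: nat. coprime p q \<and> 1 \<le> q \<and> 2 * q + 1 \<le> p}"
  have "card (UNIV :: 'a set) \<noteq> Suc 0" using assms by linarith
  then have "UNIV \<noteq> {undefined :: 'a}" by (metis card_1_singleton_iff)
  then obtain a b :: 'a where ab: "a \<noteq> b" by blast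
  show ?thesis
  proof (intro exI[of _ ?D] conjI subsetI)
    fix c assume "c \<in> ?D"
    then obtain p q :: nat where c: "c = ln (real p) / (ln p - ln q)"
      and pq: "coprime p q" "1 \<le> q" "2 * q + 1 \<le> p" by blast
    \<comment> \<open>Subtracting a nonnegative \<open>ln q\<close> smaller than \<open>ln p\<close>
      leaves a positive denominator not above \<open>ln p\<close>, so the ratio is at least
      1.\<close>
    have "0 \<le> ln (real q)" "ln (real q) < ln (real p)" using pq by auto
    then show "c \<in> {1..}" by (simp add: c)
    show "c \<in> {a::real. \<exists>p q. \<exists>\<omega> :: nat \<Rightarrow> 'a. is_toeplitz_word p q \<omega> \<and>
           has_amorphic_complexity (subshift_metric \<omega>) shift (ereal a)}"
      using ex_toeplitz_word_amorphic_complexity[OF ab pq] c by blast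
  qed (use dense_log_ratios in auto)
qed

end
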